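(* Let $T$ be a totally ordered set and $\mu$ a non-degenerate probability measure on $T$, with set of atoms $\mathcal{A}$, atom masses $m_\alpha=\mu(\{\alpha\})$ and diffuse mass $m_d=\mu(T\setminus\mathcal{A})$. Then the means of the run lengths are $$\mathbb{E}[N_0^{<}]=-1+e^{m_d}\prod_{\alpha\in\mathcal{A}}(1+m_\alpha),\qquad \mathbb{E}[N_0^{\le}]=-1+e^{m_d}\prod_{\alpha\in\mathcal{A}}\frac1{1-m_\alpha},$$ and for every $i\ge1$, $$\mathbb{E}[N_i^{<}\mid S_i^{<}]=\frac{2}{1+\sum_{\alpha\in\mathcal{A}}m_\alpha^2},\qquad \mathbb{E}[N_i^{\le}\mid S_i^{\le}]=\frac{2}{1-\sum_{\alpha\in\mathcal{A}}m_\alpha^2}.$$ Further, the variances are $$\mathrm{var}(N_0^{<})=\Big(e^{m_d}\prod_{\alpha\in\mathcal{A}}(1+m_\alpha)\Big)\Big(3-e^{m_d}\prod_{\alpha\in\mathcal{A}}(1+m_\alpha)-2\sum_{\alpha\in\mathcal{A}}\frac{m_\alpha^2}{1+m_\alpha}\Big),$$ $$\mathrm{var}(N_0^{\le})=\Big(e^{m_d}\prod_{\alpha\in\mathcal{A}}\frac{1}{1-m_\alpha}\Big)\Big(3-e^{m_d}\prod_{\alpha\in\mathcal{A}}\frac1{1-m_\alpha}+2\sum_{\alpha\in\mathcal{A}}\frac{m_\alpha^2}{1-m_\alpha}\Big),$$ and for every $i\ge1$, $$\mathrm{var}(N_i^{<}\mid S_i^{<})=\frac{2}{1+\sum_{\alpha\in\mathcal{A}}m_\alpha^2}\Big(-3+2e^{m_d}\prod_{\alpha\in\mathcal{A}}(1+m_\alpha)-\frac{2}{1+\sum_{\alpha\in\mathcal{A}}m_\alpha^2}\Big),$$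 $$\mathrm{var}(N_i^{\le}\mid S_i^{\le})=\frac{2}{1-\sum_{\alpha\in\mathcal{A}}m_\alpha^2}\Big(-3+2e^{m_d}\prod_{\alpha\in\mathcal{A}}\frac1{1-m_\alpha}-\frac{2}{1-\sum_{\alpha\in\mathcal{A}}m_\alpha^2}\Big).$$
   Context: $T$ carries a $\sigma$-algebra such that $\{(x,y)\in T^2: x<y\}$ is measurable for the product $\sigma$-algebra on $T^2$ (since $T$ is totally ordered, $\{x\le y\}$ and all singletons are then measurable too). Measures on $T$ are defined on this $\sigma$-algebra. Atoms: $\mathcal{A}=\{x\in T:\mu(\{x\})>0\}$ (a countable set). $\mu$ is degenerate if there is $x\in T$ with $\mu(\{x\})=\mu(T)$, and non-degenerate otherwise. Runs: $X_0,X_1,X_2,\dots$ are i.i.d. $T$-valued random variables with law $\mu$ on a probability space $(\Omega,\mathcal{F},\mathbb{P})$. The event that a strict run begins at $i$ is $S_0^{<}=\Omega$ and $S_i^{<}=\{X_{i-1}\not< X_i\}$ for $i\ge1$; the event that a non-strict run begins at $i$ is $S_0^{\le}=\Omega$ and $S_i^{\le}=\{X_{i-1}\not\le X_i\}$ for $i\ge1$. The run length $N_i^{<}$ is defined only on $S_i^{<}$, with values in $\{1,2,\dots\}\cup\{\infty\}$: for finite $n\ge1$, $\{N_i^{<}=n\}=S_i^{<}\cap\{X_i<X_{i+1}<\dots<X_{i+n-1}\}\cap\{X_{i+n-1}\not<X_{i+n}\}$ (the chain condition being vacuous for $n=1$), and $\{N_i^{<}=\infty\}=S_i^{<}\cap\{X_i<X_{i+1}<\cdots\}$.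 $N_i^{\le}$ is defined on $S_i^{\le}$ in the same way with $<,\not<$ replaced by $\le,\not\le$. Conditional mean and variance given $S_i^{<}$ (resp. $S_i^{\le}$) are those under $\mathbb{P}(\cdot\mid S_i^{<})$ (resp. $\mathbb{P}(\cdot\mid S_i^{\le})$). *)

theory Defs
  imports "HOL-Probability.Probability"
begin

(* The totally ordered set T is the space of the measure mu, as a subset of a linearly ordered
   type. *)

definition atoms :: "'a measure \<Rightarrow> 'a set" where
  "atoms \<mu> = {x \<in> space \<mu>. measure \<mu> {x} > 0}"

definition degenerate :: "'a measure \<Rightarrow> bool" where
  "degenerate \<mu> \<longleftrightarrow> (\<exists>x\<in>space \<mu>. measure \<mu> {x} = measure \<mu> (space \<mu>))"


(* Product over an arbitrary index set, as the unordered limit of the finite partial products,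
   in analogy with infsum. *)

definition infprod :: "('a \<Rightarrow> real) \<Rightarrow> 'a set \<Rightarrow> real" where
  "infprod f A = Lim (finite_subsets_at_top A) (prod f)"

lemma infprod_exp:
  assumes "(g has_sum s) A" and "\<And>x. x \<in> A \<Longrightarrow> f x = exp (g x)"
  shows "(prod f \<longlongrightarrow> exp s) (finite_subsets_at_top A)" and "infprod f A = exp s"
proof -
  have "((\<lambda>F. exp (sum g F)) \<longlongrightarrow> exp s) (finite_subsets_at_top A)"
    using assms(1) by (intro tendsto_exp) (simp add: has_sum_def)
  moreover have "eventually (\<lambda>F. exp (sum g F) = prod f F) (finite_subsets_at_top A)"
    unfolding eventually_finite_subsets_at_top
    by (rule exI[of _ "{}"]) (auto simp: exp_sum assms(2) intro!: prod.cong)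
  ultimately show *: "(prod f \<longlongrightarrow> exp s) (finite_subsets_at_top A)"
    using Lim_transform_eventually by blast
  then show "infprod f A = exp s"
    unfolding infprod_def by (intro tendsto_Lim) auto
qed


(* R is the relation along a run: (<) for strict and (<=) for non-strict runs. The run length at i
   is defined only on the event that a run begins at i; elsewhere it is the unspecified value
   undefined. *)

definition run_start ::
    "('a \<Rightarrow> 'a \<Rightarrow> bool) \<Rightarrow> 'b measure \<Rightarrow> (nat \<Rightarrow> 'b \<Rightarrow> 'a) \<Rightarrow> nat \<Rightarrow> 'b set" where
  "run_start R P X i =
     (if i = 0 then space P else {\<omega> \<in> space P. \<not> R (X (i - 1) \<omega>) (X i \<omega>)})"

definition run_length ::
    "('a \<Rightarrow> 'a \<Rightarrow> bool) \<Rightarrow> 'b measure \<Rightarrow> (nat \<Rightarrow> 'b \<Rightarrow> 'a) \<Rightarrow> nat \<Rightarrow> 'b \<Rightarrow> enat" where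
  "run_length R P X i =
     (\<lambda>\<omega>\<in>run_start R P X i.
        if \<forall>k. R (X (i + k) \<omega>) (X (i + k + 1) \<omega>) then \<infinity>
        else enat (LEAST n. 1 \<le> n \<and> \<not> R (X (i + n - 1) \<omega>) (X (i + n) \<omega>)))"

lemma run_length_eq_infinity_iff:
  assumes "\<omega> \<in> run_start R P X i"
  shows "run_length R P X i \<omega> = \<infinity> \<longleftrightarrow> (\<forall>k. R (X (i + k) \<omega>) (X (i + k + 1) \<omega>))"
  using assms by (simp add: run_length_def)

lemma run_length_eq_enat_iff:
  assumes "\<omega> \<in> run_start R P X i"
  shows "run_length R P X i \<omega> = enat n \<longleftrightarrow>
    1 \<le> n \<and> (\<forall>k. k + 1 < n \<longrightarrow> R (X (i + k) \<omega>) (X (i + k + 1) \<omega>)) \<and>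
    \<not> R (X (i + n - 1) \<omega>) (X (i + n) \<omega>)" (is "?l \<longleftrightarrow> ?r")
proof -
  let ?Q = "\<lambda>n. 1 \<le> n \<and> \<not> R (X (i + n - 1) \<omega>) (X (i + n) \<omega>)"
  show ?thesis
  proof
    assume l: ?l
    then have inf: "\<not> (\<forall>k. R (X (i + k) \<omega>) (X (i + k + 1) \<omega>))"
      and n: "n = (LEAST n. ?Q n)"
      using assms by (auto simp: run_length_def split: if_splits)
    from inf obtain k where "?Q (Suc k)" by auto
    then have "?Q n" unfolding n by (rule LeastI)
    moreover have "R (X (i + k) \<omega>) (X (i + k + 1) \<omega>)" if "k + 1 < n" for k
      using not_less_Least[of "Suc k" ?Q] that n by auto
    ultimately show ?r by blast
  next
    assume r: ?r
    have "(LEAST n. ?Q n) = n"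
    proof (rule Least_equality)
      show "?Q n" using r by blast
      show "n \<le> m" if m: "?Q m" for m
      proof (rule ccontr)
        assume "\<not> n \<le> m"
        then have "(m - 1) + 1 < n" using m by simp
        then have "R (X (i + (m - 1)) \<omega>) (X (i + (m - 1) + 1) \<omega>)" using r by blast
        then show False using m by simp
      qed
    qed
    moreover have "\<not> R (X (i + (n - 1)) \<omega>) (X (i + (n - 1) + 1) \<omega>)" using r by simp
    then have "\<not> (\<forall>k. R (X (i + k) \<omega>) (X (i + k + 1) \<omega>))" by blast
    ultimately show ?l using assms by (simp add: run_length_def)
  qed
qed

lemma measurable_run_start:
  assumes "Measurable.pred (\<mu> \<Otimes>\<^sub>M \<mu>) (\<lambda>p. R (fst p) (snd p))"
    and X: "\<And>i. X i \<in> measurable P \<mu>"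
  shows "run_start R P X i \<in> sets P"
proof -
  have "Measurable.pred P (\<lambda>\<omega>. R (X (i - 1) \<omega>) (X i \<omega>))"
    using measurable_compose[OF measurable_Pair[OF X X] assms(1)] by simp
  then show ?thesis by (auto simp: run_start_def)
qed

lemma measurable_run_length:
  assumes R: "Measurable.pred (\<mu> \<Otimes>\<^sub>M \<mu>) (\<lambda>p. R (fst p) (snd p))"
    and X: "\<And>i. X i \<in> measurable P \<mu>"
  shows "run_length R P X i \<in> measurable P (count_space UNIV)"
proof -
  have [measurable]: "Measurable.pred P (\<lambda>\<omega>. R (X j \<omega>) (X k \<omega>))" for j k
    using measurable_compose[OF measurable_Pair[OF X X] R] by simp
  have [measurable]: "run_start R P X i \<in> sets P"
    by (rule measurable_run_start[OF assms])
  show ?thesis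
    unfolding run_length_def restrict_def by measurable
qed


(* Mean and variance of a random variable that may take the value infinity, as extended reals. *)

definition enat_mean :: "'b measure \<Rightarrow> ('b \<Rightarrow> enat) \<Rightarrow> ereal" where
  "enat_mean Q N = enn2ereal (\<integral>\<^sup>+\<omega>. ennreal_of_enat (N \<omega>) \<partial>Q)"

definition enat_variance :: "'b measure \<Rightarrow> ('b \<Rightarrow> enat) \<Rightarrow> ereal" where
  "enat_variance Q N =
     enn2ereal (\<integral>\<^sup>+\<omega>. e2ennreal ((ereal_of_enat (N \<omega>) - enat_mean Q N)\<^sup>2) \<partial>Q)"

lemma enat_mean_real:
  assumes N[measurable]: "N \<in> measurable Q (count_space UNIV)"
    and mean: "enat_mean Q N = ereal m"
  shows "AE \<omega> in Q. N \<omega> \<noteq> \<infinity>"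
    and "integrable Q (\<lambda>\<omega>. real (the_enat (N \<omega>)))"
    and "(\<integral>\<omega>. real (the_enat (N \<omega>)) \<partial>Q) = m"
proof -
  have I: "(\<integral>\<^sup>+\<omega>. ennreal_of_enat (N \<omega>) \<partial>Q) = ennreal m" and m: "m \<ge> 0"
    using mean enn2ereal_nonneg[of "\<integral>\<^sup>+\<omega>. ennreal_of_enat (N \<omega>) \<partial>Q"]
    unfolding enat_mean_def by (auto simp flip: e2ennreal_ereal simp del: enn2ereal_nonneg)
      (metis e2ennreal_enn2ereal)
  have "AE \<omega> in Q. ennreal_of_enat (N \<omega>) \<noteq> \<infinity>"
    by (rule nn_integral_noteq_infinite) (auto simp: I)
  then show fin: "AE \<omega> in Q. N \<omega> \<noteq> \<infinity>"
    by eventually_elim (metis ennreal_of_enat_infty)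
  have "(\<integral>\<^sup>+\<omega>. ennreal (real (the_enat (N \<omega>))) \<partial>Q) = (\<integral>\<^sup>+\<omega>. ennreal_of_enat (N \<omega>) \<partial>Q)"
    by (rule nn_integral_cong_AE, use fin in eventually_elim)
      (auto simp: ennreal_of_nat_eq_real_of_nat)
  with I have *: "(\<integral>\<^sup>+\<omega>. ennreal (real (the_enat (N \<omega>))) \<partial>Q) = ennreal m" by simp
  show "integrable Q (\<lambda>\<omega>. real (the_enat (N \<omega>)))"
    by (rule integrableI_nn_integral_finite[OF _ _ *]) auto
  show "(\<integral>\<omega>. real (the_enat (N \<omega>)) \<partial>Q) = m"
    using m * by (subst integral_eq_nn_integral) auto
qed

lemma enat_variance_real:
  assumes N[measurable]: "N \<in> measurable Q (count_space UNIV)"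
    and mean: "enat_mean Q N = ereal m" and var: "enat_variance Q N = ereal v"
  shows "integrable Q (\<lambda>\<omega>. (real (the_enat (N \<omega>)) - m)\<^sup>2)"
    and "(\<integral>\<omega>. (real (the_enat (N \<omega>)) - (\<integral>\<omega>. real (the_enat (N \<omega>)) \<partial>Q))\<^sup>2 \<partial>Q) = v"
proof -
  let ?I = "\<integral>\<^sup>+\<omega>. e2ennreal ((ereal_of_enat (N \<omega>) - enat_mean Q N)\<^sup>2) \<partial>Q"
  have I: "?I = ennreal v" and v: "v \<ge> 0"
    using var enn2ereal_nonneg[of ?I]
    unfolding enat_variance_def by (auto simp flip: e2ennreal_ereal simp del: enn2ereal_nonneg)
      (metis e2ennreal_enn2ereal)
  have "(\<integral>\<^sup>+\<omega>. ennreal ((real (the_enat (N \<omega>)) - m)\<^sup>2) \<partial>Q) = ?I"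
    by (rule nn_integral_cong_AE, use enat_mean_real(1)[OF N mean] in eventually_elim)
      (auto simp: mean e2ennreal_ereal)
  with I have *: "(\<integral>\<^sup>+\<omega>. ennreal ((real (the_enat (N \<omega>)) - m)\<^sup>2) \<partial>Q) = ennreal v" by simp
  show "integrable Q (\<lambda>\<omega>. (real (the_enat (N \<omega>)) - m)\<^sup>2)"
    by (rule integrableI_nn_integral_finite[OF _ _ *]) auto
  show "(\<integral>\<omega>. (real (the_enat (N \<omega>)) - (\<integral>\<omega>. real (the_enat (N \<omega>)) \<partial>Q))\<^sup>2 \<partial>Q) = v"
    unfolding enat_mean_real(3)[OF N mean]
    using v * by (subst integral_eq_nn_integral) auto
qed

end

theory Submission
  imports Defs
begin

text \<open>
  Let \<open>e n\<close> be the probability that \<open>n\<close> independent points form a chain. Given a chain \<open>x\<close>, a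
  further point \<open>y\<close> can be inserted in exactly \<open>1 + s * card {i. x i = y}\<close> positions, where \<open>s = -1\<close> for
  strict and \<open>s = 1\<close> for non-strict chains. Integrating this over \<open>y\<close> yields Newton's identities
  \<open>(n + 1) * e (n + 1) = (\<Sum>k\<le>n. q k * e (n - k))\<close> with \<open>q k = \<integral>(s * \<mu>{x})^k \<partial>\<mu>\<close>, so the generating
  function \<open>G\<close> of \<open>e\<close> satisfies \<open>G' = G * (\<Sum>k. q k * t^k)\<close>. As the masses of the atoms are bounded
  away from 1, the series converge beyond \<open>t = 1\<close>, and \<open>G 1\<close> and \<open>G' 1\<close> have the stated closed
  forms. The tail probabilities of the run lengths are \<open>e (n + 1)\<close> at 0 and
  \<open>(e (n + 1) - e (n + 2)) / (1 - e 2)\<close> later on.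
\<close>

subsection \<open>Generating functions\<close>

text \<open>The recursion is the coefficient form of \<open>g' = Q * g\<close> for the power series
  \<open>g\<close> of \<open>e\<close> and \<open>Q\<close> of \<open>q\<close>, so
  \<open>g = exp L\<close> with \<open>L' = Q\<close> and \<open>L 0 = 0\<close>. The two sums are
  the values of \<open>g\<close> and \<open>g'\<close> at 1; the geometric bound on \<open>q\<close>
  gives convergence beyond 1, so that differentiation is legitimate there.\<close>

lemma convolution_recursion_sums:
  fixes e q :: "nat \<Rightarrow> real" and M :: real
  assumes e0: "e 0 = 1"
    and rec: "\<And>n. (real n + 1) * e (Suc n) = (\<Sum>k\<le>n. q k * e (n - k))"
    and q: "\<And>k. \<bar>q k\<bar> \<le> M ^ k" and M: "0 < M" "M < 1"
  defines "G \<equiv> exp (\<Sum>k. q k / (real k + 1))"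
  shows "e sums G" and "(\<lambda>n. real n * e n) sums (G * (\<Sum>k. q k))"
proof -
  \<comment> \<open>\<open>S\<close> majorises the right-hand side of the recursion and obeys a
    one-step recursion of its own, which makes a ratio test available.\<close>
  define S where "S n = (\<Sum>k\<le>n. M ^ k * \<bar>e (n - k)\<bar>)" for n
  have S_nonneg: "S n \<ge> 0" for n
    unfolding S_def using M by (intro sum_nonneg) auto
  have e_le: "(real n + 1) * \<bar>e (Suc n)\<bar> \<le> S n" for n
  proof -
    have "(real n + 1) * \<bar>e (Suc n)\<bar> = \<bar>(real n + 1) * e (Suc n)\<bar>"
      by (simp add: abs_mult)
    also have "\<dots> \<le> (\<Sum>k\<le>n. \<bar>q k * e (n - k)\<bar>)"
      unfolding rec by (rule sum_abs)
    also have "\<dots> \<le> S n"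
      unfolding S_def abs_mult by (intro sum_mono mult_right_mono q) auto
    finally show ?thesis .
  qed
  have S_Suc: "S (Suc n) = \<bar>e (Suc n)\<bar> + M * S n" for n
    unfolding S_def sum.atMost_Suc_shift by (simp add: sum_distrib_left mult.assoc)
  have e_le_S: "\<bar>e n\<bar> \<le> S n" for n
    unfolding S_def using M by (subst sum.atMost_shift) (auto intro!: sum_nonneg)

  \<comment> \<open>By \<open>e_le\<close> and \<open>S_Suc\<close> the ratio of consecutive
    \<open>S\<close> is at most \<open>M + 1 / (n + 1)\<close>, which lies below \<open>r\<close>
    from some \<open>N\<close> on. Any \<open>\<rho>\<close> strictly between 1 and
    \<open>1 / r\<close> is then a point of absolute convergence beyond 1.\<close>
  define r where "r = (1 + M) / 2"
  have r: "M < r" "r < 1" using M by (auto simp: r_def)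
  then have "1 < 1 / r" using M by (simp add: field_simps)
  then obtain \<rho> where \<rho>: "1 < \<rho>" "\<rho> < 1 / r" using dense by blast
  have r\<rho>: "r * \<rho> < 1" using \<rho> r M by (simp add: field_simps)
  have "M * \<rho> < r * \<rho>" using r \<rho> by (intro mult_strict_right_mono) auto
  then have M\<rho>: "M * \<rho> < 1" using r\<rho> by linarith
  obtain N :: nat where N: "1 / (r - M) < real N" using reals_Archimedean2 by blast
  have "summable (\<lambda>n. S n * \<rho> ^ n)"
  proof (rule summable_ratio_test[of "r * \<rho>" N])
    show "r * \<rho> < 1" by fact
    fix n assume n: "N \<le> n"
    have "1 < (real n + 1) * (r - M)"
    proof -
      have "1 < real N * (r - M)" using N r by (simp add: field_simps)
      also have "\<dots> \<le> (real n + 1) * (r - M)" using n r by (intro mult_right_mono) auto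
      finally show ?thesis .
    qed
    then have "S n \<le> (real n + 1) * (r - M) * S n"
      using mult_right_mono[of 1 "(real n + 1) * (r - M)" "S n"] S_nonneg[of n] by simp
    then have "(real n + 1) * \<bar>e (Suc n)\<bar> \<le> (real n + 1) * ((r - M) * S n)"
      using order_trans[OF e_le] by (simp only: mult.assoc)
    then have "\<bar>e (Suc n)\<bar> \<le> (r - M) * S n"
      by (subst (asm) mult_le_cancel_left_pos) auto
    then have "S (Suc n) \<le> r * S n" unfolding S_Suc by (simp add: algebra_simps)
    then have "S (Suc n) * \<rho> ^ Suc n \<le> r * S n * \<rho> ^ Suc n"
      using \<rho> by (intro mult_right_mono) auto
    then show "norm (S (Suc n) * \<rho> ^ Suc n) \<le> r * \<rho> * norm (S n * \<rho> ^ n)"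
      using S_nonneg \<rho> by (simp add: abs_mult mult_ac)
  qed
  then have e_\<rho>: "summable (\<lambda>n. norm (e n * \<rho> ^ n))"
  proof (rule summable_comparison_test')
    show "norm (norm (e n * \<rho> ^ n)) \<le> S n * \<rho> ^ n" for n
      using mult_right_mono[OF e_le_S, of "\<rho> ^ n" n] \<rho> by (simp add: abs_mult)
  qed
  have q_\<rho>: "summable (\<lambda>n. norm (q n * \<rho> ^ n))"
  proof (rule summable_comparison_test')
    show "summable (\<lambda>n. (M * \<rho>) ^ n)" using M\<rho> M \<rho> by (intro summable_geometric) simp
    show "norm (norm (q n * \<rho> ^ n)) \<le> (M * \<rho>) ^ n" for n
      using mult_right_mono[OF q, of "\<rho> ^ n" n] \<rho> by (simp add: abs_mult power_mult_distrib)
  qed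
  \<comment> \<open>Coefficients of the antiderivative of \<open>Q\<close> that vanishes at
    0.\<close>
  define l where "l n = (if n = 0 then 0 else q (n - 1) / real n)" for n
  have l_\<rho>: "summable (\<lambda>n. l n * \<rho> ^ n)"
  proof -
    have "summable (\<lambda>n. l (Suc n) * \<rho> ^ Suc n)"
    proof (rule summable_comparison_test')
      show "summable (\<lambda>n. \<rho> * norm (q n * \<rho> ^ n))" using q_\<rho> by (rule summable_mult)
      show "norm (l (Suc n) * \<rho> ^ Suc n) \<le> \<rho> * norm (q n * \<rho> ^ n)" for n
      proof -
        have "norm (l (Suc n) * \<rho> ^ Suc n) = \<rho> * norm (q n * \<rho> ^ n) / (1 + real n)"
          using \<rho> by (simp add: l_def abs_mult mult_ac)
        also have "\<dots> \<le> \<rho> * norm (q n * \<rho> ^ n) / 1"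
          using \<rho> by (intro divide_left_mono) auto
        finally show ?thesis by simp
      qed
    qed
    then show ?thesis by (subst (asm) summable_Suc_iff)
  qed

  define g where "g t = (\<Sum>n. e n * t ^ n)" for t
  define L where "L t = (\<Sum>n. l n * t ^ n)" for t
  define Q where "Q t = (\<Sum>n. q n * t ^ n)" for t
  have smaller: "summable (\<lambda>n. norm (c n * t ^ n))"
    if "summable (\<lambda>n. norm (c n * \<rho> ^ n))" "0 \<le> t" "t \<le> 1" for c :: "nat \<Rightarrow> real" and t
    using that \<rho>
    by (intro summable_comparison_test'[OF that(1)])
      (auto simp: abs_mult intro!: mult_left_mono power_mono)
  have diffs_e: "diffs e n = (\<Sum>k\<le>n. q k * e (n - k))" for n
    using rec[of n] by (simp add: diffs_def add.commute)
  have diffs_l: "diffs l = q"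
    by (simp add: diffs_def l_def fun_eq_iff)
  \<comment> \<open>A Cauchy product turns the recursion into \<open>g' = Q * g\<close>.\<close>
  have conv: "(\<lambda>n. diffs e n * t ^ n) sums (Q t * g t)" if "0 \<le> t" "t \<le> 1" for t
  proof -
    have "(\<lambda>n. \<Sum>k\<le>n. (q k * t ^ k) * (e (n - k) * t ^ (n - k))) sums (Q t * g t)"
      unfolding Q_def g_def
      by (rule Cauchy_product_sums[OF smaller[OF q_\<rho> that] smaller[OF e_\<rho> that]])
    moreover have "(\<Sum>k\<le>n. (q k * t ^ k) * (e (n - k) * t ^ (n - k))) = diffs e n * t ^ n"
      for n
      unfolding diffs_e sum_distrib_right
    proof (intro sum.cong refl)
      fix k assume "k \<in> {..n}"
      then have t: "t ^ n = t ^ k * t ^ (n - k)" by (simp flip: power_add)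
      show "(q k * t ^ k) * (e (n - k) * t ^ (n - k)) = q k * e (n - k) * t ^ n"
        unfolding t by (simp only: mult_ac)
    qed
    ultimately show ?thesis by (simp only:)
  qed
  have g': "(g has_real_derivative Q t * g t) (at t)" if "0 \<le> t" "t \<le> 1" for t
  proof -
    have "(g has_real_derivative (\<Sum>n. diffs e n * t ^ n)) (at t)"
      unfolding g_def[abs_def]
      by (rule termdiffs_strong[OF summable_norm_cancel[OF e_\<rho>]]) (use that \<rho> in auto)
    then show ?thesis by (simp only: sums_unique[OF conv[OF that], symmetric])
  qed
  have L': "(L has_real_derivative Q t) (at t)" if "0 \<le> t" "t \<le> 1" for t
    unfolding L_def[abs_def] Q_def diffs_l[symmetric]
    by (rule termdiffs_strong[OF l_\<rho>]) (use that \<rho> in auto)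
  \<comment> \<open>\<open>exp (- L t)\<close> is an integrating factor for this equation.\<close>
  have deriv: "((\<lambda>t. g t * exp (- L t)) has_real_derivative 0) (at t)" if "0 \<le> t" "t \<le> 1" for t
    using DERIV_mult[OF g'[OF that] DERIV_fun_exp[OF DERIV_minus[OF L'[OF that]]]]
    by (simp add: algebra_simps)
  have "g 1 * exp (- L 1) = g 0 * exp (- L 0)"
  proof (rule DERIV_isconst_end[of 0 1 "\<lambda>t. g t * exp (- L t)"])
    show "continuous_on {0..1} (\<lambda>t. g t * exp (- L t))"
      by (intro continuous_at_imp_continuous_on ballI DERIV_isCont[OF deriv]) auto
  qed (use deriv in auto)
  also have "\<dots> = 1"
    unfolding g_def L_def powser_zero by (simp add: e0 l_def)
  finally have g1L: "g 1 = exp (L 1)"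
    by (simp add: exp_minus field_simps)
  have "summable l"
    using powser_inside[OF l_\<rho>, of 1] \<rho> by simp
  then have "L 1 = (\<Sum>n. l (Suc n))"
    unfolding L_def by (subst suminf_split_head) (simp_all add: l_def[of 0])
  also have "(\<lambda>n. l (Suc n)) = (\<lambda>n. q n / (real n + 1))"
    unfolding l_def by (intro ext) simp
  finally have g1: "g 1 = G"
    unfolding g1L G_def by (rule arg_cong)
  show "e sums G"
    using summable_norm_cancel[OF smaller[OF e_\<rho>, of 1]] g1 by (simp add: g_def sums_iff)
  \<comment> \<open>This is \<open>g'\<close> at 1; the index shift that follows only adds the
    vanishing term for \<open>n = 0\<close>.\<close>
  have "(\<lambda>n. diffs e n) sums (G * (\<Sum>k. q k))"
    using conv[of 1] unfolding g1 Q_def by (simp add: mult.commute)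
  then show "(\<lambda>n. real n * e n) sums (G * (\<Sum>k. q k))"
    unfolding diffs_def using sums_Suc_iff[of "\<lambda>n. real n * e n"]
    by (simp only: of_nat_0 mult_zero_left add_0_right)
qed

text \<open>The logarithm series at \<open>1 - u\<close>; the factor \<open>u\<close> on the left,
  instead of a division on the right, admits \<open>u = 0\<close>.\<close>

lemma ln_one_minus_series:
  fixes u :: real
  assumes "\<bar>u\<bar> < 1"
  shows "u * (\<Sum>k. u ^ k / (real k + 1)) = - ln (1 - u)"
proof -
  have "summable (\<lambda>k. u ^ k / (real k + 1))"
  proof (rule summable_comparison_test')
    show "summable (\<lambda>k. \<bar>u\<bar> ^ k)" using assms by (intro summable_geometric) simp
    show "norm (u ^ k / (real k + 1)) \<le> \<bar>u\<bar> ^ k" for k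
      using divide_left_mono[of 1 "real k + 1" "\<bar>u\<bar> ^ k"] by (simp add: power_abs)
  qed
  then have sum: "summable (\<lambda>k. u * (u ^ k / (real k + 1)))"
    and mult: "u * (\<Sum>k. u ^ k / (real k + 1)) = (\<Sum>k. u * (u ^ k / (real k + 1)))"
    by (rule summable_mult, rule suminf_mult[symmetric])
  have "ln (1 - u) = (\<Sum>k. (-1)^k * (1 / real (k + 1)) * ((1 - u) - 1)^(Suc k))"
    using assms by (intro ln_series) auto
  also have "\<dots> = (\<Sum>k. - (u * (u ^ k / (real k + 1))))"
  proof (rule suminf_cong)
    fix k :: nat
    have "(- 1) ^ k * (- u) ^ k = u ^ k"
      by (simp flip: power_mult_distrib)
    then show "(-1)^k * (1 / real (k + 1)) * ((1 - u) - 1)^(Suc k) = - (u * (u ^ k / (real k + 1)))"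
      by (simp add: field_simps)
  qed
  also have "\<dots> = - (\<Sum>k. u * (u ^ k / (real k + 1)))"
    by (rule suminf_minus[OF sum])
  finally show ?thesis unfolding mult by simp
qed

subsection \<open>Chains of independent points\<close>

text \<open>A value absent from a chain fits at exactly one position. In a non-strict chain,
  \<open>k\<close> equal entries form a block with \<open>k + 1\<close> admissible positions for a
  further copy; in a strict chain a value already present has none. No insertion makes a chain out
  of a list that is not one.\<close>

lemma sum_sorted_wrt_insert:
  fixes R :: "'a::linorder \<Rightarrow> 'a \<Rightarrow> bool" and s :: real
  assumes R: "R = (<) \<and> s = - 1 \<or> R = (\<le>) \<and> s = 1"
  shows "(\<Sum>i\<le>length xs. of_bool (sorted_wrt R (take i xs @ y # drop i xs))) =
    of_bool (sorted_wrt R xs) * (1 + s * count_list xs y)"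
proof (induction xs)
  have set_take_drop: "set (take i xs) \<union> set (drop i xs) = set xs" for i and xs :: "'a list"
    by (simp flip: set_append)

  case (Cons x xs)
  \<comment> \<open>The position in front of \<open>x\<close> is split off; every later one requires
    \<open>x\<close> to be related to \<open>y\<close> and to all of \<open>xs\<close>.\<close>
  have "(\<Sum>i\<le>length (x # xs). of_bool (sorted_wrt R (take i (x # xs) @ y # drop i (x # xs)))) =
    of_bool (sorted_wrt R (y # x # xs)) + 
    (\<Sum>i\<le>length xs. of_bool (R x y \<and> (\<forall>z\<in>set xs. R x z)) *
      of_bool (sorted_wrt R (take i xs @ y # drop i xs)) :: real)"
    unfolding length_Cons sum.atMost_Suc_shift of_bool_conj[symmetric]
    by (intro arg_cong2[of _ _ _ _ "(+)"] sum.cong refl arg_cong[of _ _ of_bool])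
      (use set_take_drop[of _ xs] in \<open>auto simp: ball_Un\<close>)
  also have "\<dots> = of_bool (sorted_wrt R (y # x # xs)) + 
     of_bool (R x y \<and> (\<forall>z\<in>set xs. R x z)) * (of_bool (sorted_wrt R xs) * (1 + s * count_list xs y))"
    by (simp only: Cons.IH flip: sum_distrib_left)
  \<comment> \<open>For \<open>y < x\<close> only the front position is possible, and
    \<open>y\<close> cannot occur in a chain starting with \<open>x\<close>. For
    \<open>y = x\<close> the front position is open in the non-strict case only.\<close>
  also have "\<dots> = of_bool (sorted_wrt R (x # xs)) * (1 + s * count_list (x # xs) y)"
    using R by (cases x y rule: linorder_cases) (auto simp: count_list_0_iff)
  finally show ?case .
qed simp

text \<open>Coupling \<open>R\<close> with the sign \<open>s\<close> lets one argument serve strict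
  and non-strict runs; the theorem instantiates it once for each.\<close>

locale run_measure = prob_space \<mu> for \<mu> :: "'a::linorder measure" +
  fixes R :: "'a \<Rightarrow> 'a \<Rightarrow> bool" and s :: real
  assumes pred_less: "Measurable.pred (\<mu> \<Otimes>\<^sub>M \<mu>) (\<lambda>p. fst p < snd p)"
    and nondegenerate: "\<not> degenerate \<mu>"
    and R: "R = (<) \<and> s = - 1 \<or> R = (\<le>) \<and> s = 1"
begin

abbreviation N :: "nat \<Rightarrow> (nat \<Rightarrow> 'a) measure" where
  "N n \<equiv> Pi\<^sub>M {..<n} (\<lambda>_. \<mu>)"

definition m :: "'a \<Rightarrow> real" where "m x = measure \<mu> {x}"

definition w :: "'a \<Rightarrow> real" where "w x = s * m x"

text \<open>For \<open>k > 0\<close> this is \<open>s ^ k\<close> times the power sum of order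
  \<open>k + 1\<close> of the atom masses; for \<open>k = 0\<close> it is the total mass 1, diffuse
  part included.\<close>

definition q :: "nat \<Rightarrow> real" where "q k = (\<integral>x. w x ^ k \<partial>\<mu>)"

definition chain :: "nat \<Rightarrow> (nat \<Rightarrow> 'a) \<Rightarrow> bool" where
  "chain n x \<longleftrightarrow> sorted_wrt R (map x [0..<n])"

text \<open>For a purely atomic measure this is the elementary (strict) or complete homogeneous
  (non-strict) symmetric function of the atom masses.\<close>

definition e :: "nat \<Rightarrow> real" where
  "e n = (\<integral>x. of_bool (chain n x) \<partial>N n)"

text \<open>An auxiliary family: \<open>k = 0\<close> gives \<open>n * e n\<close>, and general
  \<open>k\<close> is what lets the recursion in \<open>n\<close> close.\<close>

definition c :: "nat \<Rightarrow> nat \<Rightarrow> real" where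
  "c n k = (\<integral>x. of_bool (chain n x) * (\<Sum>i<n. w (x i) ^ k) \<partial>N n)"

section \<open>Measurability of the order and of point masses, and bounds on the masses\<close>

lemma measurable_less [measurable (raw)]:
  assumes "f \<in> measurable M \<mu>" "g \<in> measurable M \<mu>"
  shows "Measurable.pred M (\<lambda>x. f x < g x)"
  using measurable_compose[OF measurable_Pair[OF assms] pred_less] by simp

lemma measurable_R [measurable (raw)]:
  assumes [measurable]: "f \<in> measurable M \<mu>" "g \<in> measurable M \<mu>"
  shows "Measurable.pred M (\<lambda>x. R (f x) (g x))"
proof -
  have "Measurable.pred M (\<lambda>x. f x < g x)" "Measurable.pred M (\<lambda>x. \<not> g x < f x)"
    by measurable
  then show ?thesis using R by (auto simp: not_less)
qed

lemma measurable_eq [measurable (raw)]: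
  assumes [measurable]: "f \<in> measurable M \<mu>" "g \<in> measurable M \<mu>"
  shows "Measurable.pred M (\<lambda>x. f x = g x)"
proof -
  have "Measurable.pred M (\<lambda>x. \<not> f x < g x \<and> \<not> g x < f x)"
    by measurable
  also have "(\<lambda>x. \<not> f x < g x \<and> \<not> g x < f x) = (\<lambda>x. f x = g x)"
    by (auto simp: fun_eq_iff not_less)
  finally show ?thesis .
qed

lemma singleton_sets:
  assumes "x \<in> space \<mu>"
  shows "{x} \<in> sets \<mu>"
proof -
  have "{y \<in> space \<mu>. x = y} \<in> sets \<mu>"
    using assms by measurable
  also have "{y \<in> space \<mu>. x = y} = {x}" using assms by auto
  finally show ?thesis .
qed

text \<open>\<open>{x}\<close> is the section at \<open>x\<close> of the measurable diagonal, and
  measures of sections depend measurably on the point.\<close>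

lemma m_measurable [measurable]: "m \<in> borel_measurable \<mu>"
proof -
  have *: "{p \<in> space (\<mu> \<Otimes>\<^sub>M \<mu>). fst p = snd p} \<in> sets (\<mu> \<Otimes>\<^sub>M \<mu>)"
    by measurable
  have "Pair x -` {p \<in> space (\<mu> \<Otimes>\<^sub>M \<mu>). fst p = snd p} = {x}" if "x \<in> space \<mu>" for x
    using that by (auto simp: space_pair_measure)
  with measurable_emeasure_Pair[OF *] show ?thesis
    unfolding m_def[abs_def] measure_def by (auto cong: measurable_cong)
qed

lemma w_measurable [measurable]: "w \<in> borel_measurable \<mu>"
  unfolding w_def[abs_def] by measurable

lemma abs_s [simp]: "\<bar>s\<bar> = 1"
  using R by auto

lemma abs_w: "\<bar>w x\<bar> = m x"
  by (simp add: w_def abs_mult m_def)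

lemma m_nonneg [simp]: "0 \<le> m x"
  by (simp add: m_def)

lemma m_less_1: "m x < 1"
proof (cases "x \<in> space \<mu>")
  case True
  then show ?thesis
    using nondegenerate prob_le_1[of "{x}"] by (auto simp: degenerate_def m_def prob_space less_le)
next
  case False
  \<comment> \<open>\<open>measure\<close> takes the default value 0 on sets that are not
    measurable.\<close>
  then have "{x} \<notin> sets \<mu>" using sets.sets_into_space by blast
  then show ?thesis by (simp add: m_def measure_notin_sets)
qed

text \<open>A point of mass above 1/2 has the largest mass, as two such points would exceed the
  total mass 1; without one, 1/2 is a bound. This \<open>M\<close> is the ratio of the geometric
  majorants used for the series in \<open>q\<close>.\<close>

lemma uniform_mass_bound:
  obtains M where "0 < M" "M < 1" "\<And>x. m x \<le> M"
proof (cases "\<exists>x. m x > 1 / 2")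
  case True
  then obtain x where x: "m x > 1 / 2" by blast
  have "m y \<le> m x" for y
  proof (rule ccontr)
    assume y: "\<not> m y \<le> m x"
    then have "{x} \<in> sets \<mu>" "{y} \<in> sets \<mu>" "x \<noteq> y"
      using x measure_notin_sets[of "{x}" \<mu>] measure_notin_sets[of "{y}" \<mu>]
      unfolding m_def by force+
    then have "measure \<mu> {x, y} = m x + m y"
      using finite_measure_Union[of "{x}" "{y}"] by (simp add: m_def insert_commute)
    with x y prob_le_1[of "{x, y}"] show False by simp
  qed
  with x m_less_1 show ?thesis by (intro that[of "m x"]) auto
next
  case False
  then show ?thesis by (intro that[of "1 / 2"]) (auto simp: not_less)
qed

lemma abs_w_power_le_1: "\<bar>w x ^ k\<bar> \<le> 1"
  using m_less_1[of x] by (simp add: power_abs abs_w power_le_one m_def)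

lemma prob_space_N: "prob_space (N n)"
  by (intro prob_space_PiM prob_space_axioms)

lemma chain_iff_nth: "chain n x \<longleftrightarrow> (\<forall>j\<in>{..<n}. \<forall>i\<in>{..<j}. R (x i) (x j))"
  by (auto simp: chain_def sorted_wrt_iff_nth_less)

lemma chain_measurable [measurable]: "Measurable.pred (N n) (chain n)"
  unfolding chain_iff_nth[abs_def]
  by (intro pred_intros_finite measurable_R measurable_component_singleton) auto

lemma component_measurable [measurable (raw)]:
  "i < n \<Longrightarrow> f \<in> measurable M (N n) \<Longrightarrow> (\<lambda>x. f x i) \<in> measurable M \<mu>"
  by (rule measurable_compose[OF _ measurable_component_singleton]) auto

lemma integrable_bounded_N:
  fixes f :: "(nat \<Rightarrow> 'a) \<Rightarrow> real"
  assumes "f \<in> borel_measurable (N n)" "\<And>x. \<bar>f x\<bar> \<le> B"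
  shows "integrable (N n) f"
proof -
  interpret N: prob_space "N n" by (rule prob_space_N)
  show ?thesis using assms by (intro N.integrable_const_bound[of f B]) auto
qed

lemma integrable_bounded:
  fixes f :: "'a \<Rightarrow> real"
  assumes "f \<in> borel_measurable \<mu>" "\<And>x. \<bar>f x\<bar> \<le> B"
  shows "integrable \<mu> f"
  using assms by (intro integrable_const_bound[of f B]) auto

lemma integrable_w_power: "integrable \<mu> (\<lambda>x. w x ^ k)"
  by (rule integrable_bounded[OF _ abs_w_power_le_1]) measurable

lemma integral_w_power_at:
  assumes "x \<in> space \<mu>"
  shows "(\<integral>y. w y ^ k * of_bool (x = y) \<partial>\<mu>) = w x ^ k * m x"
proof -
  have "(\<integral>y. w y ^ k * of_bool (x = y) \<partial>\<mu>) = (\<integral>y. indicator {x} y * w x ^ k \<partial>\<mu>)"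
    by (intro Bochner_Integration.integral_cong) (auto simp: indicator_def)
  also have "\<dots> = w x ^ k * m x"
    using singleton_sets[OF assms] by (simp add: m_def)
  finally show ?thesis .
qed

section \<open>Inserting a point into a chain, and Newton's identities\<close>

definition ins :: "nat \<Rightarrow> nat \<Rightarrow> (nat \<Rightarrow> 'a) \<Rightarrow> nat \<Rightarrow> 'a" where
  "ins n i x = (\<lambda>j\<in>{..<Suc n}. x (if j < i then j else if j = i then n else j - 1))"

lemma ins_measurable [measurable]:
  "i \<le> n \<Longrightarrow> ins n i \<in> measurable (N (Suc n)) (N (Suc n))"
  unfolding ins_def[abs_def] by (intro measurable_restrict measurable_component_singleton) auto

text \<open>\<open>ins n i\<close> moves the last coordinate to place \<open>i\<close> and shifts
  the later ones by one; a product of equal factors is invariant under permutations of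
  coordinates.\<close>

lemma integral_ins:
  assumes i: "i \<le> n" and g: "g \<in> borel_measurable (N (Suc n))"
  shows "(\<integral>x. g x \<partial>N (Suc n)) = (\<integral>x. g (ins n i x) \<partial>N (Suc n) :: real)"
proof -
  let ?f = "\<lambda>j. if j < i then j else if j = i then n else j - 1"
  have inj: "inj_on ?f {..<Suc n}" and ran: "?f \<in> {..<Suc n} \<rightarrow> {..<Suc n}"
    using i by (auto simp: inj_on_def split: if_splits)
  have "distr (N (Suc n)) (N (Suc n)) (ins n i) = N (Suc n)"
    unfolding ins_def[abs_def] by (rule distr_PiM_reindex[OF prob_space_axioms inj ran])
  then show ?thesis
    using integral_distr[OF ins_measurable[OF i] g] by simp
qed

lemma map_ins:
  assumes "i \<le> n"
  shows "map (ins n i x) [0..<Suc n] = take i (map x [0..<n]) @ x n # drop i (map x [0..<n])"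
  unfolding ins_def using assms
  by (intro nth_equalityI)
    (auto simp: nth_append nth_Cons simp del: upt_Suc split: nat.split intro!: arg_cong[of _ _ x])

lemma count_list_map_upt: "real (count_list (map x [0..<n]) y) = (\<Sum>j<n. of_bool (x j = y))"
  by (induction n) auto

text \<open>By exchangeability the weighted point may be taken as the last one, inserted into a
  chain of the other \<open>n\<close>. The number of positions is 1 plus \<open>s\<close> times a
  multiplicity; integrating out the inserted point, the 1 yields \<open>q k\<close> and each
  coincidence with \<open>x j\<close> yields \<open>w (x j) ^ Suc k\<close>.\<close>

lemma c_Suc: "c (Suc n) k = e n * q k + c n (Suc k)"
proof -
  interpret product_sigma_finite "\<lambda>_::nat. \<mu>" ..
  let ?f = "\<lambda>x. of_bool (chain n x) * (1 + s * (\<Sum>j<n. of_bool (x j = x n))) * w (x n) ^ k"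
  have abs_f: "\<bar>?f x\<bar> \<le> 1 + real n" for x
  proof -
    have "\<bar>1 + s * (\<Sum>j<n. of_bool (x j = x n))\<bar> \<le> 1 + \<bar>s * (\<Sum>j<n. of_bool (x j = x n))\<bar>"
      using abs_triangle_ineq[of 1 "s * (\<Sum>j<n. of_bool (x j = x n))"] by simp
    also have "\<dots> \<le> 1 + real n"
      using sum_bounded_above[of "{..<n}" "\<lambda>j. of_bool (x j = x n)" "1::real"]
      by (simp add: abs_mult sum_nonneg del: sum_of_bool_eq)
    finally show ?thesis
      using mult_mono[OF _ abs_w_power_le_1[of "x n" k],
        of "\<bar>1 + s * (\<Sum>j<n. of_bool (x j = x n))\<bar>" "1 + real n"]
      by (simp add: abs_mult del: sum_of_bool_eq)
  qed
  have "c (Suc n) k = (\<Sum>i\<le>n. \<integral>x. of_bool (chain (Suc n) x) * w (x i) ^ k \<partial>N (Suc n))"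
    unfolding c_def sum_distrib_left lessThan_Suc_atMost[symmetric]
    by (intro Bochner_Integration.integral_sum integrable_bounded_N[where B=1])
      (use abs_w_power_le_1 in \<open>auto simp: abs_mult\<close>)
  \<comment> \<open>Place \<open>i\<close> of \<open>ins n i x\<close> holds \<open>x n\<close>, so
    the weight becomes independent of \<open>i\<close> and the sum counts insertion
    positions.\<close>
  also have "\<dots> = (\<Sum>i\<le>n. \<integral>x. of_bool (chain (Suc n) (ins n i x)) * w (x n) ^ k \<partial>N (Suc n))"
  proof (intro sum.cong refl)
    fix i assume "i \<in> {..n}"
    then have i: "i \<le> n" by simp
    show "(\<integral>x. of_bool (chain (Suc n) x) * w (x i) ^ k \<partial>N (Suc n)) =
      (\<integral>x. of_bool (chain (Suc n) (ins n i x)) * w (x n) ^ k \<partial>N (Suc n))"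
      using i by (subst integral_ins[OF i]) (measurable, simp add: ins_def)
  qed
  also have "\<dots> = (\<integral>x. (\<Sum>i\<le>n. of_bool (chain (Suc n) (ins n i x)) * w (x n) ^ k) \<partial>N (Suc n))"
    by (intro Bochner_Integration.integral_sum[symmetric] integrable_bounded_N[where B=1])
      (use abs_w_power_le_1 in \<open>auto simp: abs_mult\<close>)
  also have "\<dots> = (\<integral>x. ?f x \<partial>N (Suc n))"
  proof (intro Bochner_Integration.integral_cong refl)
    fix x
    have "(\<Sum>i\<le>n. of_bool (chain (Suc n) (ins n i x)) * w (x n) ^ k) =
      (\<Sum>i\<le>n. of_bool (sorted_wrt R (take i (map x [0..<n]) @ x n # drop i (map x [0..<n])))) *
      w (x n) ^ k"
      unfolding sum_distrib_right chain_def by (intro sum.cong refl) (simp add: map_ins del: upt_Suc)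
    also have "\<dots> = ?f x"
      using sum_sorted_wrt_insert[OF R, of "map x [0..<n]" "x n"]
      by (simp add: count_list_map_upt chain_def del: sum_of_bool_eq)
    finally show "(\<Sum>i\<le>n. of_bool (chain (Suc n) (ins n i x)) * w (x n) ^ k) = ?f x" .
  qed
  \<comment> \<open>Fubini: the inserted point is integrated out with the chain held fixed.\<close>
  also have "\<dots> = (\<integral>x. \<integral>y. ?f (x(n := y)) \<partial>\<mu> \<partial>N n)"
  proof -
    have "integrable (N (Suc n)) ?f"
    proof (rule integrable_bounded_N[OF _ abs_f])
      have "Measurable.pred (N (Suc n)) (chain n)"
        unfolding chain_iff_nth[abs_def]
        by (intro pred_intros_finite measurable_R measurable_component_singleton) auto
      then show "?f \<in> borel_measurable (N (Suc n))" by measurable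
    qed
    then show ?thesis
      unfolding lessThan_Suc by (intro product_integral_insert) auto
  qed
  also have "\<dots> = (\<integral>x. of_bool (chain n x) * (q k + (\<Sum>j<n. w (x j) ^ Suc k)) \<partial>N n)"
  proof (intro Bochner_Integration.integral_cong refl)
    fix x assume x: "x \<in> space (N n)"
    then have xj: "x j \<in> space \<mu>" if "j < n" for j
      using that by (auto simp: space_PiM)
    have chain: "chain n (x(n := y)) = chain n x" for y
      by (auto simp: chain_iff_nth)
    have int: "integrable \<mu> (\<lambda>y. w y ^ k * of_bool (x j = y))" if "j < n" for j
    proof (rule integrable_bounded[where B=1])
      show "(\<lambda>y. w y ^ k * of_bool (x j = y)) \<in> borel_measurable \<mu>"
        using xj[OF that] by measurable
    qed (use abs_w_power_le_1 in \<open>auto simp: abs_mult\<close>)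
    have "(\<integral>y. ?f (x(n := y)) \<partial>\<mu>) = (\<integral>y. of_bool (chain n x) *
        (w y ^ k + s * (\<Sum>j<n. w y ^ k * of_bool (x j = y))) \<partial>\<mu>)"
      by (intro Bochner_Integration.integral_cong refl)
        (simp add: chain sum_distrib_left algebra_simps del: sum_of_bool_eq)
    also have "\<dots> = of_bool (chain n x) *
        (q k + s * (\<Sum>j<n. \<integral>y. w y ^ k * of_bool (x j = y) \<partial>\<mu>))"
    proof -
      have "integrable \<mu> (\<lambda>y. s * (\<Sum>j<n. w y ^ k * of_bool (x j = y)))"
        using int by (intro integrable_mult_right Bochner_Integration.integrable_sum) simp
      moreover have "(\<integral>y. (\<Sum>j<n. w y ^ k * of_bool (x j = y)) \<partial>\<mu>) =
        (\<Sum>j<n. \<integral>y. w y ^ k * of_bool (x j = y) \<partial>\<mu>)"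
        using int by (intro Bochner_Integration.integral_sum) simp
      ultimately show ?thesis
        by (simp add: integrable_w_power q_def del: sum_of_bool_eq sum_mult_of_bool_eq)
    qed
    also have "(\<Sum>j<n. \<integral>y. w y ^ k * of_bool (x j = y) \<partial>\<mu>) = (\<Sum>j<n. w (x j) ^ k * m (x j))"
      by (intro sum.cong refl integral_w_power_at xj) simp
    \<comment> \<open>The sign from the count and the mass from the integral combine into one more
      factor \<open>w\<close>.\<close>
    also have "s * (\<Sum>j<n. w (x j) ^ k * m (x j)) = (\<Sum>j<n. w (x j) ^ Suc k)"
      by (simp add: sum_distrib_left w_def mult_ac)
    finally show "(\<integral>y. ?f (x(n := y)) \<partial>\<mu>) = of_bool (chain n x) * (q k + (\<Sum>j<n. w (x j) ^ Suc k))" .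
  qed
  also have "\<dots> = e n * q k + c n (Suc k)"
  proof -
    have "integrable (N n) (\<lambda>x. of_bool (chain n x) * (\<Sum>j<n. w (x j) ^ Suc k))"
      unfolding sum_distrib_left
      by (intro Bochner_Integration.integrable_sum integrable_bounded_N[where B=1])
        (use abs_w_power_le_1[of _ "Suc k"] in \<open>auto simp: abs_mult simp del: power_Suc\<close>)
    moreover have "integrable (N n) (\<lambda>x. of_bool (chain n x) * q k)"
      by (intro integrable_mult_left integrable_bounded_N[where B=1]) auto
    ultimately show ?thesis
      unfolding distrib_left e_def c_def by (subst Bochner_Integration.integral_add) auto
  qed
  finally show ?thesis .
qed

text \<open>Unrolling \<open>c_Suc\<close> trades one point for one more power at each step and ends
  at \<open>c 0\<close>, an empty sum.\<close>

lemma c_Suc_conv: "c (Suc n) k = (\<Sum>j\<le>n. q (k + j) * e (n - j))"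
proof (induction n arbitrary: k)
  case 0
  show ?case by (simp add: c_Suc c_def[of 0])
next
  case (Suc n)
  show ?case
    unfolding c_Suc[of "Suc n"] Suc.IH sum.atMost_Suc_shift by simp
qed

lemma c_0: "c n 0 = real n * e n"
  by (simp add: c_def e_def)

text \<open>At \<open>k = 0\<close> every chain of \<open>n + 1\<close> points is counted
  \<open>n + 1\<close> times, which gives Newton's identity.\<close>

lemma e_rec: "(real n + 1) * e (Suc n) = (\<Sum>k\<le>n. q k * e (n - k))"
  using c_0[of "Suc n"] c_Suc_conv[of n 0] by (simp add: add.commute)

lemma e_0: "e 0 = 1"
  using prob_space.prob_space[OF prob_space_N[of 0]] by (simp add: e_def chain_def)

lemma abs_q_le:
  assumes "\<And>x. m x \<le> M"
  shows "\<bar>q k\<bar> \<le> M ^ k"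
proof -
  have "\<bar>q k\<bar> \<le> (\<integral>x. \<bar>w x ^ k\<bar> \<partial>\<mu>)"
    unfolding q_def by (rule integral_abs_bound)
  also have "\<dots> \<le> (\<integral>x. M ^ k \<partial>\<mu>)"
    using assms by (intro integral_mono integrable_abs integrable_w_power)
      (auto simp: power_abs abs_w m_def intro!: power_mono)
  finally show ?thesis by (simp add: prob_space)
qed

lemma q_0: "q 0 = 1"
  by (simp add: q_def prob_space)

section \<open>Integrals of functions of the point mass as sums over atoms\<close>

lemma countable_atoms: "countable (atoms \<mu>)"
  by (rule countable_subset[OF _ countable_support]) (auto simp: atoms_def)

lemma atoms_sets [measurable]: "atoms \<mu> \<in> sets \<mu>"
  by (rule sets.countable[OF singleton_sets countable_atoms]) (auto simp: atoms_def)

text \<open>Off the atoms \<open>m\<close> vanishes, so the integrand is the constant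
  \<open>f 0\<close>; on the countable set of atoms \<open>\<mu>\<close> is counting measure with
  density \<open>m\<close>.\<close>

lemma has_sum_atoms:
  fixes f :: "real \<Rightarrow> real"
  assumes f [measurable]: "(\<lambda>x. f (m x)) \<in> borel_measurable \<mu>" and B: "\<And>x. \<bar>f (m x)\<bar> \<le> B"
  shows "((\<lambda>\<alpha>. m \<alpha> * f (m \<alpha>)) has_sum
    (\<integral>x. f (m x) \<partial>\<mu>) - f 0 * measure \<mu> (space \<mu> - atoms \<mu>)) (atoms \<mu>)"
proof -
  let ?A = "atoms \<mu>"
  have int: "integrable \<mu> (\<lambda>x. f (m x))"
    by (rule integrable_bounded[OF f B])
  have A: "?A \<inter> space \<mu> = ?A" by (auto simp: atoms_def)
  have "restrict_space \<mu> ?A = density (count_space ?A) m"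
  proof (rule measure_eqI_countable[of _ ?A])
    have "B \<in> sets \<mu>" if "B \<subseteq> ?A" for B
      by (rule sets.countable[OF singleton_sets countable_subset[OF that countable_atoms]])
        (use that in \<open>auto simp: atoms_def\<close>)
    then show "sets (restrict_space \<mu> ?A) = Pow ?A"
      using atoms_sets by (auto simp: sets_restrict_space_iff A)
    show "emeasure (restrict_space \<mu> ?A) {a} = emeasure (density (count_space ?A) m) {a}"
      if "a \<in> ?A" for a
      using that by (subst emeasure_restrict_space)
       (auto simp: A emeasure_density m_def emeasure_eq_measure nn_integral_count_space_indicator
          one_ennreal_def[symmetric])
  qed (auto simp: countable_atoms)
  then have "integrable (density (count_space ?A) m) (\<lambda>x. f (m x))"
    and "(\<integral>x. f (m x) \<partial>density (count_space ?A) m) = (\<integral>x. indicator ?A x *\<^sub>R f (m x) \<partial>\<mu>)"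
    using integrable_restrict_space[of ?A \<mu> "\<lambda>x. f (m x)"]
      integral_restrict_space[of ?A \<mu> "\<lambda>x. f (m x)"] integrable_mult_indicator[OF atoms_sets int]
    by (auto simp: A)
  then have int_m: "integrable (count_space ?A) (\<lambda>x. m x * f (m x))"
    and 1: "(\<integral>x. m x * f (m x) \<partial>count_space ?A) = (\<integral>x. indicator ?A x *\<^sub>R f (m x) \<partial>\<mu>)"
    by (auto simp: integrable_density integral_density m_def)
  \<comment> \<open>Integrability against counting measure is absolute summability, hence unordered
    summability.\<close>
  note abs = int_m[folded Infinite_Set_Sum.abs_summable_on_def]
  then have "(\<lambda>x. m x * f (m x)) summable_on ?A"
    using abs_summable_equivalent abs_summable_summable by blast
  then have "((\<lambda>x. m x * f (m x)) has_sum (\<integral>x. indicator ?A x *\<^sub>R f (m x) \<partial>\<mu>)) ?A"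
    using has_sum_infsum infsetsum_infsum[OF abs] 1 by (simp add: infsetsum_def)
  moreover have "(\<integral>x. f (m x) \<partial>\<mu>) =
    (\<integral>x. indicator ?A x *\<^sub>R f (m x) \<partial>\<mu>) + f 0 * measure \<mu> (space \<mu> - ?A)"
  proof -
    have "(\<integral>x. f (m x) \<partial>\<mu>) =
      (\<integral>x. indicator ?A x *\<^sub>R f (m x) + indicator (space \<mu> - ?A) x *\<^sub>R f 0 \<partial>\<mu>)"
      by (intro Bochner_Integration.integral_cong refl)
        (auto simp: indicator_def atoms_def m_def not_less measure_le_0_iff)
    also have "\<dots> = (\<integral>x. indicator ?A x *\<^sub>R f (m x) \<partial>\<mu>) + (\<integral>x. indicator (space \<mu> - ?A) x *\<^sub>R f 0 \<partial>\<mu>)"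
      by (intro Bochner_Integration.integral_add integrable_mult_indicator int) auto
    finally show ?thesis by simp
  qed
  ultimately show ?thesis by simp
qed

text \<open>Sum and integral may be exchanged because the terms are dominated by
  \<open>M ^ k\<close>.\<close>

lemma integral_w_series:
  fixes a :: "nat \<Rightarrow> real"
  assumes a: "\<And>k. \<bar>a k\<bar> \<le> 1"
  shows "(\<Sum>k. q k * a k) = (\<integral>x. (\<Sum>k. w x ^ k * a k) \<partial>\<mu>)"
proof -
  obtain M where M: "0 < M" "M < 1" "\<And>x. m x \<le> M" using uniform_mass_bound by blast
  have le: "\<bar>w x ^ k * a k\<bar> \<le> M ^ k" for x k
    using mult_mono[of "m x ^ k" "M ^ k" "\<bar>a k\<bar>" 1] M a[of k]
    by (simp add: abs_mult power_abs abs_w power_mono m_def)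
  have geo: "summable (\<lambda>k. M ^ k)" using M by (intro summable_geometric) simp
  have int: "integrable \<mu> (\<lambda>x. w x ^ k * a k)" for k
    by (intro integrable_mult_left integrable_w_power)
  have "(\<integral>x. (\<Sum>k. w x ^ k * a k) \<partial>\<mu>) = (\<Sum>k. \<integral>x. w x ^ k * a k \<partial>\<mu>)"
  proof (rule integral_suminf[OF int])
    show "AE x in \<mu>. summable (\<lambda>k. norm (w x ^ k * a k))"
      using le by (intro AE_I2 summable_comparison_test'[OF geo]) simp
    have "(\<integral>x. norm (w x ^ k * a k) \<partial>\<mu>) \<le> (\<integral>x. M ^ k \<partial>\<mu>)" for k
      using le int by (intro integral_mono integrable_norm) auto
    then show "summable (\<lambda>k. \<integral>x. norm (w x ^ k * a k) \<partial>\<mu>)"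
      by (intro summable_comparison_test'[OF geo]) (simp add: prob_space)
  qed
  then show ?thesis by (simp add: q_def)
qed

lemma suminf_q: "(\<Sum>k. q k) = 1 + s * (\<Sum>\<^sub>\<infinity>\<alpha>\<in>atoms \<mu>. (m \<alpha>)\<^sup>2 / (1 - s * m \<alpha>))"
proof -
  obtain M where M: "0 < M" "M < 1" "\<And>x. m x \<le> M" using uniform_mass_bound by blast
  have pos: "1 - w x \<ge> 1 - M" for x
    using M(3)[of x] abs_w[of x] by linarith
  \<comment> \<open>The geometric series minus its constant term 1; as it vanishes at 0, the diffuse
    part contributes nothing.\<close>
  let ?f = "\<lambda>u. s * u / (1 - s * u)"
  have bound: "\<bar>?f (m x)\<bar> \<le> 1 / (1 - M)" for x
    using pos[of x] abs_w[of x] m_less_1[of x] M(2)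
    by (auto simp: w_def[symmetric] abs_divide intro!: frac_le)
  have meas: "(\<lambda>x. ?f (m x)) \<in> borel_measurable \<mu>" by measurable
  have "(\<Sum>k. q k) = (\<integral>x. (\<Sum>k. w x ^ k) \<partial>\<mu>)"
    using integral_w_series[of "\<lambda>_. 1"] by simp
  also have "\<dots> = (\<integral>x. 1 + ?f (m x) \<partial>\<mu>)"
  proof (intro Bochner_Integration.integral_cong refl)
    fix x
    have "(\<Sum>k. w x ^ k) = 1 / (1 - w x)"
      using abs_w[of x] m_less_1[of x] by (intro suminf_geometric) simp
    also have "\<dots> = 1 + ?f (m x)"
      using pos[of x] M(2) by (simp add: w_def[symmetric] field_simps)
    finally show "(\<Sum>k. w x ^ k) = 1 + ?f (m x)" .
  qed
  also have "\<dots> = 1 + (\<integral>x. ?f (m x) \<partial>\<mu>)"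
    using integrable_bounded[OF meas bound] by (simp add: prob_space)
  also have "(\<integral>x. ?f (m x) \<partial>\<mu>) = (\<Sum>\<^sub>\<infinity>\<alpha>\<in>atoms \<mu>. m \<alpha> * ?f (m \<alpha>))"
    using has_sum_atoms[of ?f, OF meas bound] by (simp add: has_sum_iff)
  also have "\<dots> = s * (\<Sum>\<^sub>\<infinity>\<alpha>\<in>atoms \<mu>. (m \<alpha>)\<^sup>2 / (1 - s * m \<alpha>))"
    by (subst infsum_cmult_right'[symmetric]) (simp add: power2_eq_square mult_ac)
  finally show ?thesis .
qed

lemma q_1: "q 1 = s * (\<Sum>\<^sub>\<infinity>\<alpha>\<in>atoms \<mu>. (m \<alpha>)\<^sup>2)"
proof -
  have "((\<lambda>\<alpha>. m \<alpha> * (s * m \<alpha>)) has_sum (\<integral>x. s * m x \<partial>\<mu>)) (atoms \<mu>)"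
    using has_sum_atoms[of "\<lambda>u. s * u" 1] m_less_1
    by (simp add: abs_mult less_imp_le)
  then have "q 1 = (\<Sum>\<^sub>\<infinity>\<alpha>\<in>atoms \<mu>. m \<alpha> * (s * m \<alpha>))"
    by (simp add: has_sum_iff q_def w_def)
  then show ?thesis
    by (subst infsum_cmult_right'[symmetric]) (simp add: power2_eq_square mult_ac)
qed

text \<open>The factor is \<open>(1 - s * m) powr (- s)\<close>, that is \<open>1 + m\<close> or
  \<open>1 / (1 - m)\<close>. The exponential form suits \<open>infprod_exp\<close> and covers both
  signs.\<close>

definition Z :: real where
  "Z = exp (measure \<mu> (space \<mu> - atoms \<mu>)) * infprod (\<lambda>\<alpha>. exp (- s * ln (1 - s * m \<alpha>))) (atoms \<mu>)"

text \<open>Each atom contributes a logarithm to the exponent and the diffuse part contributes its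
  mass, so exponentiation yields the product and the factor \<open>exp m_d\<close>.\<close>

lemma exp_suminf_q: "exp (\<Sum>k. q k / (real k + 1)) = Z"
proof -
  let ?f = "\<lambda>u. \<Sum>k. (s * u) ^ k / (real k + 1)"
  obtain M where M: "0 < M" "M < 1" "\<And>x. m x \<le> M" using uniform_mass_bound by blast
  have le: "\<bar>w x ^ k / (real k + 1)\<bar> \<le> M ^ k" for x k
    using frac_le[of "M ^ k" "m x ^ k" 1 "real k + 1"] M
    by (simp add: abs_divide power_abs abs_w power_mono m_def)
  have geo: "summable (\<lambda>k. M ^ k)" using M by (intro summable_geometric) simp
  have bound: "\<bar>?f (m x)\<bar> \<le> (\<Sum>k. M ^ k)" for x
    using norm_suminf_le[OF _ geo, of "\<lambda>k. (s * m x) ^ k / (real k + 1)"] le[of x]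
    by (simp add: w_def)
  have meas: "(\<lambda>x. ?f (m x)) \<in> borel_measurable \<mu>" by measurable
  \<comment> \<open>Only the term for \<open>k = 0\<close> survives; this value is the weight of the
    diffuse mass in \<open>has_sum_atoms\<close>.\<close>
  have f0: "?f 0 = 1"
    using powser_zero[of "\<lambda>k. 1 / (real k + 1)"] by simp
  have eq: "m \<alpha> * ?f (m \<alpha>) = - s * ln (1 - s * m \<alpha>)" for \<alpha>
  proof -
    have "m \<alpha> * ?f (m \<alpha>) = s * (s * m \<alpha> * ?f (m \<alpha>))" using R by auto
    also have "s * m \<alpha> * ?f (m \<alpha>) = - ln (1 - s * m \<alpha>)"
      using abs_w[of \<alpha>] m_less_1[of \<alpha>] by (intro ln_one_minus_series) (simp add: w_def)
    finally show ?thesis by simp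
  qed
  have "(\<Sum>k. q k / (real k + 1)) = (\<integral>x. ?f (m x) \<partial>\<mu>)"
    using integral_w_series[of "\<lambda>k. 1 / (real k + 1)"] by (simp add: w_def)
  moreover have "infprod (\<lambda>\<alpha>. exp (- s * ln (1 - s * m \<alpha>))) (atoms \<mu>) =
    exp ((\<integral>x. ?f (m x) \<partial>\<mu>) - measure \<mu> (space \<mu> - atoms \<mu>))"
    using has_sum_atoms[of ?f, OF meas bound]
    unfolding eq f0 by (intro infprod_exp(2)) auto
  ultimately show ?thesis
    unfolding Z_def by (simp flip: exp_add)
qed

text \<open>The values at 1 of the generating function of \<open>e\<close> and of its
  derivative.\<close>

lemma e_sums: "e sums Z"
  and e_mean_sums: "(\<lambda>n. real n * e n) sums
    (Z * (1 + s * (\<Sum>\<^sub>\<infinity>\<alpha>\<in>atoms \<mu>. (m \<alpha>)\<^sup>2 / (1 - s * m \<alpha>))))"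
proof -
  obtain M where M: "0 < M" "M < 1" "\<And>x. m x \<le> M" using uniform_mass_bound by blast
  note * = convolution_recursion_sums[of e q, OF e_0 e_rec abs_q_le[OF M(3)] M(1,2)]
  show "e sums Z" using *(1) by (simp only: exp_suminf_q)
  show "(\<lambda>n. real n * e n) sums (Z * (1 + s * (\<Sum>\<^sub>\<infinity>\<alpha>\<in>atoms \<mu>. (m \<alpha>)\<^sup>2 / (1 - s * m \<alpha>))))"
    using *(2) by (simp only: exp_suminf_q suminf_q)
qed

end

subsection \<open>Run lengths\<close>

text \<open>A square is a sum of consecutive odd numbers; this expresses second moments through
  tails.\<close>

lemma suminf_odd_below: "(\<Sum>n. ennreal ((2 * real n + 1) * of_bool (n < j))) = ennreal ((real j)\<^sup>2)"
proof (rule suminf_ennreal_eq)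
  have "(\<Sum>n<j. 2 * real n + 1) = (real j)\<^sup>2"
    by (induction j) (auto simp: power2_eq_square algebra_simps)
  moreover have "(\<lambda>n. (2 * real n + 1) * of_bool (n < j)) sums (\<Sum>n<j. (2 * real n + 1) * of_bool (n < j))"
    by (rule sums_finite) auto
  ultimately show "(\<lambda>n. (2 * real n + 1) * of_bool (n < j)) sums (real j)\<^sup>2"
    by (simp del: sum_mult_of_bool_eq)
qed auto

text \<open>The mean is the sum of the tails, and the second moment is the sum of the tails with
  weights \<open>2 * n + 1\<close>.\<close>

lemma enat_moments_tail_sums:
  assumes Q: "prob_space Q" and N[measurable]: "N \<in> measurable Q (count_space UNIV)"
    and b: "\<And>n. measure Q {\<omega> \<in> space Q. enat n < N \<omega>} = b n"
    and S1: "b sums S1" and S2: "(\<lambda>n. (2 * real n + 1) * b n) sums S2"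
  shows "enat_mean Q N = ereal S1" and "enat_variance Q N = ereal (S2 - S1\<^sup>2)"
proof -
  interpret prob_space Q by (rule Q)
  have b_nonneg: "0 \<le> b n" for n by (simp flip: b)
  have S1_nonneg: "0 \<le> S1" using S1 b_nonneg by (metis sums_le sums_zero)
  have S2_nonneg: "0 \<le> S2" using S2 b_nonneg by (intro sums_le[OF _ sums_zero S2]) simp
  have em: "emeasure Q {\<omega> \<in> space Q. enat n < N \<omega>} = ennreal (b n)" for n
    by (simp add: emeasure_eq_measure b)
  show mean: "enat_mean Q N = ereal S1"
    unfolding enat_mean_def
    by (simp add: nn_integral_enat_function em suminf_ennreal_eq[OF b_nonneg S1]
        enn2ereal_ennreal S1_nonneg)
  \<comment> \<open>The finite mean excludes the value infinity almost everywhere, so the rest can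
    be computed with reals.\<close>
  note real = enat_mean_real[OF N mean]
  let ?Z = "\<lambda>\<omega>. real (the_enat (N \<omega>))"
  have "(\<integral>\<^sup>+\<omega>. ennreal ((?Z \<omega>)\<^sup>2) \<partial>Q) =
    (\<integral>\<^sup>+\<omega>. (\<Sum>n. ennreal (2 * real n + 1) * indicator {\<omega> \<in> space Q. enat n < N \<omega>} \<omega>) \<partial>Q)"
  proof (rule nn_integral_cong_AE)
    show "AE \<omega> in Q. ennreal ((?Z \<omega>)\<^sup>2) =
      (\<Sum>n. ennreal (2 * real n + 1) * indicator {\<omega> \<in> space Q. enat n < N \<omega>} \<omega>)"
      using real(1) AE_space
    proof eventually_elim
      case (elim \<omega>)
      then obtain j where "N \<omega> = enat j" by auto
      then have "ennreal ((?Z \<omega>)\<^sup>2) = (\<Sum>n. ennreal ((2 * real n + 1) * of_bool (n < j)))"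
        by (simp only: suminf_odd_below the_enat.simps)
      also have "\<dots> = (\<Sum>n. ennreal (2 * real n + 1) * indicator {\<omega> \<in> space Q. enat n < N \<omega>} \<omega>)"
        using elim \<open>N \<omega> = enat j\<close> by (intro suminf_cong) (simp add: indicator_def)
      finally show ?case .
    qed
  qed
  also have "\<dots> = (\<Sum>n. ennreal (2 * real n + 1) * emeasure Q {\<omega> \<in> space Q. enat n < N \<omega>})"
    by (subst nn_integral_suminf) (auto simp: nn_integral_cmult_indicator)
  also have "\<dots> = (\<Sum>n. ennreal ((2 * real n + 1) * b n))"
    by (simp add: em ennreal_mult b_nonneg)
  also have "\<dots> = ennreal S2"
    using b_nonneg by (intro suminf_ennreal_eq S2) auto
  finally have sq: "(\<integral>\<^sup>+\<omega>. ennreal ((?Z \<omega>)\<^sup>2) \<partial>Q) = ennreal S2" .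
  then have int_sq: "integrable Q (\<lambda>\<omega>. (?Z \<omega>)\<^sup>2)"
    by (intro integrableI_nn_integral_finite[of _ _ S2]) auto
  have sq': "(\<integral>\<omega>. (?Z \<omega>)\<^sup>2 \<partial>Q) = S2"
    using sq S2_nonneg by (subst integral_eq_nn_integral) auto
  have "(\<integral>\<^sup>+\<omega>. e2ennreal ((ereal_of_enat (N \<omega>) - enat_mean Q N)\<^sup>2) \<partial>Q) =
    (\<integral>\<^sup>+\<omega>. ennreal ((?Z \<omega> - S1)\<^sup>2) \<partial>Q)"
    by (rule nn_integral_cong_AE, use real(1) in eventually_elim) (auto simp: mean e2ennreal_ereal)
  also have "\<dots> = ennreal (\<integral>\<omega>. (?Z \<omega> - S1)\<^sup>2 \<partial>Q)"
  proof (rule nn_integral_eq_integral)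
    show "integrable Q (\<lambda>\<omega>. (?Z \<omega> - S1)\<^sup>2)"
      unfolding power2_diff using int_sq real(2) by auto
  qed auto
  also have "(\<integral>\<omega>. (?Z \<omega> - S1)\<^sup>2 \<partial>Q) = S2 - S1\<^sup>2"
    using variance_eq[OF real(2) int_sq] by (simp only: real(3) sq')
  finally have *: "(\<integral>\<^sup>+\<omega>. e2ennreal ((ereal_of_enat (N \<omega>) - enat_mean Q N)\<^sup>2) \<partial>Q) = ennreal (S2 - S1\<^sup>2)" .
  \<comment> \<open>Needed because \<open>ennreal\<close> would send a negative number to 0.\<close>
  have "0 \<le> S2 - S1\<^sup>2"
    using variance_eq[OF real(2) int_sq] variance_positive[of ?Z] by (simp only: real(3) sq')
  then show "enat_variance Q N = ereal (S2 - S1\<^sup>2)"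
    unfolding enat_variance_def * by (simp add: enn2ereal_ennreal)
qed

text \<open>The whole sequence has the infinite product law; the window starting at \<open>i\<close>
  is its image under the injective reindexing \<open>k\<close> to \<open>i + k\<close>.\<close>

lemma (in prob_space) distr_shifted_iid:
  assumes "prob_space \<mu>" and indep: "indep_vars (\<lambda>_. \<mu>) X UNIV"
    and law: "\<And>i. distr M \<mu> (X i) = \<mu>"
  shows "distr M (Pi\<^sub>M {..<n::nat} (\<lambda>_. \<mu>)) (\<lambda>\<omega>. \<lambda>k\<in>{..<n}. X (i + k) \<omega>) = Pi\<^sub>M {..<n} (\<lambda>_. \<mu>)"
proof -
  let ?U = "Pi\<^sub>M UNIV (\<lambda>_::nat. \<mu>)" and ?N = "Pi\<^sub>M {..<n} (\<lambda>_. \<mu>)"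
  have X: "X j \<in> measurable M \<mu>" for j
    using indep by (simp add: indep_vars_def)
  have "distr M ?U (\<lambda>\<omega>. \<lambda>j\<in>UNIV. X j \<omega>) = ?U"
    using indep X by (subst (asm) indep_vars_iff_distr_eq_PiM) (auto simp: law)
  then have "?N = distr (distr M ?U (\<lambda>\<omega>. \<lambda>j\<in>UNIV. X j \<omega>)) ?N (\<lambda>x. \<lambda>k\<in>{..<n}. x (i + k))"
    using distr_PiM_reindex[of UNIV "\<lambda>_. \<mu>" "\<lambda>k. i + k" "{..<n}"] assms(1)
    by (simp add: inj_on_def)
  also have "\<dots> = distr M ?N ((\<lambda>x. \<lambda>k\<in>{..<n}. x (i + k)) \<circ> (\<lambda>\<omega>. \<lambda>j\<in>UNIV. X j \<omega>))"
    using X by (intro distr_distr measurable_restrict measurable_component_singleton) auto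
  also have "(\<lambda>x. \<lambda>k\<in>{..<n}. x (i + k)) \<circ> (\<lambda>\<omega>. \<lambda>j\<in>UNIV. X j \<omega>) = (\<lambda>\<omega>. \<lambda>k\<in>{..<n}. X (i + k) \<omega>)"
    by (auto simp: fun_eq_iff)
  finally show ?thesis ..
qed

section \<open>Tail probabilities and moments of the run lengths\<close>

context run_measure
begin

text \<open>By transitivity neighbours suffice; this links the pairwise form of chains, suited to
  insertion, with runs, which compare neighbours only.\<close>

lemma chain_iff_Suc: "chain n x \<longleftrightarrow> (\<forall>k. Suc k < n \<longrightarrow> R (x k) (x (Suc k)))"
proof -
  have "transp R" using R by auto
  then show ?thesis by (simp add: chain_def sorted_wrt_iff_nth_Suc_transp)
qed

lemma chain_Suc_shift:
  "chain (Suc n) x \<longleftrightarrow> (0 < n \<longrightarrow> R (x 0) (x 1)) \<and> chain n (\<lambda>k. x (Suc k))"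
  by (cases n) (simp_all add: chain_iff_Suc All_less_Suc2)

text \<open>A length above \<open>n\<close> means that \<open>n + 1\<close> points are in order,
  whence the index \<open>Suc n\<close>; infinite runs are included.\<close>

lemma less_run_length_iff:
  assumes "\<omega> \<in> run_start R P X i"
  shows "enat n < run_length R P X i \<omega> \<longleftrightarrow> chain (Suc n) (\<lambda>k. X (i + k) \<omega>)"
proof (cases "run_length R P X i \<omega>")
  case (enat j)
  note j = enat[unfolded run_length_eq_enat_iff[OF assms]]
  show ?thesis
  proof
    assume "enat n < run_length R P X i \<omega>"
    with enat j show "chain (Suc n) (\<lambda>k. X (i + k) \<omega>)" by (auto simp: chain_iff_Suc)
  next
    assume *: "chain (Suc n) (\<lambda>k. X (i + k) \<omega>)"
    have "\<not> j \<le> n"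
    proof
      assume "j \<le> n"
      \<comment> \<open>The comparison that ends a run of length \<open>j\<close> would lie inside
        the chain.\<close>
      then have "R (X (i + (j - 1)) \<omega>) (X (i + Suc (j - 1)) \<omega>)"
        using * j unfolding chain_iff_Suc
        by (metis Suc_diff_1 le_imp_less_Suc less_eq_Suc_le One_nat_def)
      then show False using j by simp
    qed
    then show "enat n < run_length R P X i \<omega>" using enat by simp
  qed
next
  case infinity
  then show ?thesis
    using run_length_eq_infinity_iff[OF assms] by (auto simp: chain_iff_Suc)
qed

lemma e_1: "e 1 = 1"
  using e_rec[of 0] by (simp add: q_0 e_0)

lemma e_2: "e 2 = (1 + q 1) / 2"
  using e_rec[of 1] by (simp add: q_0 e_0 e_1[simplified] numeral_2_eq_2)

text \<open>Ensures that the conditioning event, of probability \<open>1 - e 2\<close>, is not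
  null.\<close>

lemma e_2_less_1: "e 2 < 1"
proof -
  obtain M where "0 < M" "M < 1" "\<And>x. m x \<le> M" using uniform_mass_bound by blast
  with abs_q_le[of M 1] show ?thesis by (simp add: e_2)
qed

lemma e_eq_measure: "e n = measure (N n) {x \<in> space (N n). chain n x}"
proof -
  have "e n = (\<integral>x. indicator {x \<in> space (N n). chain n x} x \<partial>N n)"
    unfolding e_def by (intro Bochner_Integration.integral_cong) (auto simp: indicator_def)
  also have "\<dots> = measure (N n) {x \<in> space (N n). chain n x}" by simp
  finally show ?thesis .
qed

definition T :: real where
  "T = (\<Sum>\<^sub>\<infinity>\<alpha>\<in>atoms \<mu>. (m \<alpha>)\<^sup>2 / (1 - s * m \<alpha>))"

text \<open>Index shifts of \<open>e_sums\<close> and \<open>e_mean_sums\<close>, removing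
  \<open>e 0 = 1\<close> and \<open>e 1 = 1\<close>. In the last sum the terms with \<open>T\<close>
  cancel, so the conditional variances do not involve it.\<close>

lemma tail_sums:
  shows "(\<lambda>n. e (Suc n)) sums (Z - 1)"
    and "(\<lambda>n. (2 * real n + 1) * e (Suc n)) sums (2 * (Z * (1 + s * T)) - (Z - 1))"
    and "(\<lambda>n. e (Suc n) - e (Suc (Suc n))) sums 1"
    and "(\<lambda>n. (2 * real n + 1) * (e (Suc n) - e (Suc (Suc n)))) sums (2 * Z - 3)"
proof -
  show 1: "(\<lambda>n. e (Suc n)) sums (Z - 1)"
    using sums_Suc_iff[of e] e_sums by (simp add: e_0)
  then have 2: "(\<lambda>n. e (Suc (Suc n))) sums (Z - 2)"
    using sums_Suc_iff[of "\<lambda>n. e (Suc n)" "Z - 2"] e_1 by simp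
  have 3: "(\<lambda>n. real (Suc n) * e (Suc n)) sums (Z * (1 + s * T))"
    using sums_Suc_iff[of "\<lambda>n. real n * e n"] e_mean_sums by (simp add: T_def del: of_nat_Suc)
  then have 4: "(\<lambda>n. real (Suc (Suc n)) * e (Suc (Suc n))) sums (Z * (1 + s * T) - 1)"
    using sums_Suc_iff[of "\<lambda>n. real (Suc n) * e (Suc n)" "Z * (1 + s * T) - 1"] e_1 by simp
  show 5: "(\<lambda>n. (2 * real n + 1) * e (Suc n)) sums (2 * (Z * (1 + s * T)) - (Z - 1))"
    using sums_diff[OF sums_mult[OF 3, of 2] 1] by (simp add: algebra_simps)
  show "(\<lambda>n. e (Suc n) - e (Suc (Suc n))) sums 1"
    using sums_diff[OF 1 2] by simp
  \<comment> \<open>The weight is written as \<open>2 * (n + 2) - 3\<close>.\<close>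
  have "(\<lambda>n. (2 * real n + 1) * e (Suc (Suc n))) sums (2 * (Z * (1 + s * T) - 1) - 3 * (Z - 2))"
    using sums_diff[OF sums_mult[OF 4, of 2] sums_mult[OF 2, of 3]] by (simp add: algebra_simps)
  from sums_diff[OF 5 this]
  show "(\<lambda>n. (2 * real n + 1) * (e (Suc n) - e (Suc (Suc n)))) sums (2 * Z - 3)"
    by (simp add: algebra_simps)
qed

text \<open>At 0 the tails are chain probabilities. Later, chains that can be extended backwards by
  one point have to be removed, so the tails are differences divided by the probability of a run
  start.\<close>

lemma run_length_moments:
  assumes P: "prob_space P" and indep: "prob_space.indep_vars P (\<lambda>_. \<mu>) X UNIV"
    and law: "\<And>i. distr P \<mu> (X i) = \<mu>"
  defines "L \<equiv> run_length R P X" and "S \<equiv> run_start R P X"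
    and "V \<equiv> (\<Sum>\<^sub>\<infinity>\<alpha>\<in>atoms \<mu>. (m \<alpha>)\<^sup>2)"
  shows "enat_mean P (L 0) = ereal (- 1 + Z)"
    and "enat_variance P (L 0) = ereal (Z * (3 - Z + 2 * s * T))"
    and "1 \<le> i \<Longrightarrow> enat_mean (uniform_measure P (S i)) (L i) = ereal (2 / (1 - s * V))"
    and "1 \<le> i \<Longrightarrow> enat_variance (uniform_measure P (S i)) (L i) =
      ereal (2 / (1 - s * V) * (- 3 + 2 * Z - 2 / (1 - s * V)))"
proof -
  interpret P: prob_space P by (rule P)
  have X [measurable]: "X i \<in> measurable P \<mu>" for i
    using indep by (simp add: P.indep_vars_def)
  have pred_R: "Measurable.pred (\<mu> \<Otimes>\<^sub>M \<mu>) (\<lambda>p. R (fst p) (snd p))"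
    by measurable
  have L_measurable: "L i \<in> measurable P (count_space UNIV)" for i
    unfolding L_def by (rule measurable_run_length[OF pred_R X])
  have S_sets [measurable]: "S i \<in> sets P" for i
    unfolding S_def by (rule measurable_run_start[OF pred_R X])
  define C where "C i n = {\<omega> \<in> space P. chain n (\<lambda>k. X (i + k) \<omega>)}" for i n
  have C_sets [measurable]: "C i n \<in> sets P" for i n
    unfolding C_def chain_iff_nth by measurable
  have C: "measure P (C i n) = e n" for i n
  proof -
    let ?Y = "\<lambda>\<omega>. \<lambda>k\<in>{..<n}. X (i + k) \<omega>"
    have Y: "?Y \<in> measurable P (N n)" by (intro measurable_restrict X)
    have "e n = measure (distr P (N n) ?Y) {x \<in> space (N n). chain n x}"
      unfolding P.distr_shifted_iid[OF prob_space_axioms indep law] by (rule e_eq_measure)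
    also have "\<dots> = measure P (?Y -` {x \<in> space (N n). chain n x} \<inter> space P)"
      using Y by (rule measure_distr) simp
    also have "?Y -` {x \<in> space (N n). chain n x} \<inter> space P = C i n"
      using measurable_space[OF Y] by (auto simp: C_def chain_iff_Suc)
    finally show ?thesis ..
  qed
  have tail: "S i \<inter> {\<omega> \<in> space P. enat n < L i \<omega>} = S i \<inter> C i (Suc n)" for i n
    by (auto simp: S_def L_def C_def less_run_length_iff)
  have S0: "S 0 = space P" by (simp add: S_def run_start_def)
  have "measure P {\<omega> \<in> space P. enat n < L 0 \<omega>} = e (Suc n)" for n
  proof -
    have "{\<omega> \<in> space P. enat n < L 0 \<omega>} = S 0 \<inter> {\<omega> \<in> space P. enat n < L 0 \<omega>}"
      unfolding S0 by blast
    also have "\<dots> = S 0 \<inter> C 0 (Suc n)"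
      by (rule tail)
    also have "\<dots> = C 0 (Suc n)"
      unfolding S0 C_def by blast
    finally show ?thesis by (simp only: C)
  qed
  note moments0 = enat_moments_tail_sums[OF P L_measurable this tail_sums(1,2)]
  show "enat_mean P (L 0) = ereal (- 1 + Z)"
    using moments0(1) by simp
  show "enat_variance P (L 0) = ereal (Z * (3 - Z + 2 * s * T))"
    using moments0(2) by (simp add: power2_eq_square algebra_simps)

  assume i: "1 \<le> i"
  obtain i' where i': "i = Suc i'" using i by (cases i) auto
  \<comment> \<open>A run starts at \<open>i\<close> exactly when the chain does not extend back to
    \<open>i'\<close>; \<open>1 \<le> n\<close> makes the link between \<open>i'\<close> and
    \<open>i\<close> part of the longer chain.\<close>
  have S_C: "S i \<inter> C i n = C i n - C i' (Suc n)" if "1 \<le> n" for n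
    using that by (auto simp: S_def run_start_def C_def chain_Suc_shift i')
  have C_subset: "C i' (Suc n) \<subseteq> C i n" for n
    by (auto simp: C_def chain_Suc_shift i')
  have S_C_measure: "measure P (S i \<inter> C i (Suc n)) = e (Suc n) - e (Suc (Suc n))" for n
    using C_subset[of "Suc n"] by (simp add: S_C P.finite_measure_Diff C)
  have "C i 1 = space P" by (auto simp: C_def chain_iff_Suc)
  then have "S i \<inter> C i 1 = S i"
    using sets.sets_into_space[OF S_sets] by auto
  \<comment> \<open>A single point is always a chain, so the case \<open>n = 0\<close> gives the
    probability of a run start.\<close>
  then have S: "measure P (S i) = 1 - e 2"
    using S_C_measure[of 0] e_1 by (simp add: numeral_2_eq_2)
  then have pos: "emeasure P (S i) \<noteq> 0" "emeasure P (S i) \<noteq> \<infinity>"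
    using e_2_less_1 by (auto simp: P.emeasure_eq_measure)
  let ?Q = "uniform_measure P (S i)"
  have Q: "prob_space ?Q" using pos by (rule prob_space_uniform_measure)
  have LQ: "L i \<in> measurable ?Q (count_space UNIV)"
    using L_measurable[of i] by (simp cong: measurable_cong_sets)
  have tailQ: "measure ?Q {\<omega> \<in> space ?Q. enat n < L i \<omega>} = (e (Suc n) - e (Suc (Suc n))) / (1 - e 2)" for n
  proof -
    note L_measurable[measurable]
    have "{\<omega> \<in> space P. enat n < L i \<omega>} \<in> sets P" by measurable
    then show ?thesis
      using pos by (simp add: tail S_C_measure S)
  qed
  have "(\<lambda>n. (2 * real n + 1) * ((e (Suc n) - e (Suc (Suc n))) / (1 - e 2))) sums ((2 * Z - 3) / (1 - e 2))"
    using sums_divide[OF tail_sums(4), of "1 - e 2"] by simp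
  note momentsQ = enat_moments_tail_sums[OF Q LQ tailQ sums_divide[OF tail_sums(3)] this]
  \<comment> \<open>Since \<open>q 1 = s * V\<close>, the probability \<open>1 - e 2\<close> equals
    \<open>(1 - s * V) / 2\<close>.\<close>
  have e2: "1 / (1 - e 2) = 2 / (1 - s * V)"
    unfolding e_2 q_1 V_def by (simp add: field_simps)
  show "enat_mean ?Q (L i) = ereal (2 / (1 - s * V))"
    using momentsQ(1) by (simp only: e2)
  have "enat_variance ?Q (L i) = ereal ((2 * Z - 3) * (1 / (1 - e 2)) - (1 / (1 - e 2))\<^sup>2)"
    using momentsQ(2) by simp
  then show "enat_variance ?Q (L i) = ereal (2 / (1 - s * V) * (- 3 + 2 * Z - 2 / (1 - s * V)))"
    unfolding e2 by (simp add: power2_eq_square algebra_simps)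
qed

end

theorem corollary2:
  fixes \<mu> :: "'a::linorder measure" and P :: "'b measure" and X :: "nat \<Rightarrow> 'b \<Rightarrow> 'a"
  assumes "{p \<in> space (\<mu> \<Otimes>\<^sub>M \<mu>). fst p < snd p} \<in> sets (\<mu> \<Otimes>\<^sub>M \<mu>)"
    and "prob_space \<mu>" and "\<not> degenerate \<mu>"
    and "prob_space P"
    and "prob_space.indep_vars P (\<lambda>_. \<mu>) X UNIV" and "\<And>i. distr P \<mu> (X i) = \<mu>"
  shows
    "let A = atoms \<mu>; m = (\<lambda>\<alpha>. measure \<mu> {\<alpha>}); m_d = measure \<mu> (space \<mu> - A);
         S_lt = run_start (<) P X; S_le = run_start (\<le>) P X;
         N_lt = run_length (<) P X; N_le = run_length (\<le>) P X
     in
       enat_mean P (N_lt 0) = ereal (- 1 + exp m_d * infprod (\<lambda>\<alpha>. 1 + m \<alpha>) A) \<and>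
       enat_mean P (N_le 0) = ereal (- 1 + exp m_d * infprod (\<lambda>\<alpha>. 1 / (1 - m \<alpha>)) A) \<and>
       (\<forall>i\<ge>1. enat_mean (uniform_measure P (S_lt i)) (N_lt i) =
          ereal (2 / (1 + (\<Sum>\<^sub>\<infinity>\<alpha>\<in>A. (m \<alpha>)\<^sup>2)))) \<and>
       (\<forall>i\<ge>1. enat_mean (uniform_measure P (S_le i)) (N_le i) =
          ereal (2 / (1 - (\<Sum>\<^sub>\<infinity>\<alpha>\<in>A. (m \<alpha>)\<^sup>2)))) \<and>
       enat_variance P (N_lt 0) =
         ereal ((exp m_d * infprod (\<lambda>\<alpha>. 1 + m \<alpha>) A) *
           (3 - exp m_d * infprod (\<lambda>\<alpha>. 1 + m \<alpha>) A
              - 2 * (\<Sum>\<^sub>\<infinity>\<alpha>\<in>A. (m \<alpha>)\<^sup>2 / (1 + m \<alpha>)))) \<and>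
       enat_variance P (N_le 0) =
         ereal ((exp m_d * infprod (\<lambda>\<alpha>. 1 / (1 - m \<alpha>)) A) *
           (3 - exp m_d * infprod (\<lambda>\<alpha>. 1 / (1 - m \<alpha>)) A
              + 2 * (\<Sum>\<^sub>\<infinity>\<alpha>\<in>A. (m \<alpha>)\<^sup>2 / (1 - m \<alpha>)))) \<and>
       (\<forall>i\<ge>1. enat_variance (uniform_measure P (S_lt i)) (N_lt i) =
          ereal (2 / (1 + (\<Sum>\<^sub>\<infinity>\<alpha>\<in>A. (m \<alpha>)\<^sup>2)) *
            (- 3 + 2 * exp m_d * infprod (\<lambda>\<alpha>. 1 + m \<alpha>) A
               - 2 / (1 + (\<Sum>\<^sub>\<infinity>\<alpha>\<in>A. (m \<alpha>)\<^sup>2))))) \<and>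
       (\<forall>i\<ge>1. enat_variance (uniform_measure P (S_le i)) (N_le i) =
          ereal (2 / (1 - (\<Sum>\<^sub>\<infinity>\<alpha>\<in>A. (m \<alpha>)\<^sup>2)) *
            (- 3 + 2 * exp m_d * infprod (\<lambda>\<alpha>. 1 / (1 - m \<alpha>)) A
               - 2 / (1 - (\<Sum>\<^sub>\<infinity>\<alpha>\<in>A. (m \<alpha>)\<^sup>2)))))"
proof -
  have less: "Measurable.pred (\<mu> \<Otimes>\<^sub>M \<mu>) (\<lambda>p. fst p < snd p)"
    using assms(1) by (simp add: pred_def)
  interpret lt: run_measure \<mu> "(<)" "- 1"
    using assms(2,3) less by (intro run_measure.intro run_measure_axioms.intro) auto
  interpret le: run_measure \<mu> "(\<le>)" 1
    using assms(2,3) less by (intro run_measure.intro run_measure_axioms.intro) auto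
  \<comment> \<open>With \<open>s = - 1\<close> the exponent in \<open>Z\<close> is
    \<open>ln (1 + m)\<close>, and with \<open>s = 1\<close> it is \<open>- ln (1 - m)\<close>; the
    latter needs masses below 1, hence non-degeneracy.\<close>
  have "exp (ln (1 + measure \<mu> {\<alpha>})) = 1 + measure \<mu> {\<alpha>}" for \<alpha>
    by (rule exp_ln) (simp add: add_pos_nonneg)
  then have Z_lt: "lt.Z = exp (measure \<mu> (space \<mu> - atoms \<mu>)) * infprod (\<lambda>\<alpha>. 1 + measure \<mu> {\<alpha>}) (atoms \<mu>)"
    by (simp add: lt.Z_def lt.m_def)
  have "exp (- ln (1 - measure \<mu> {\<alpha>})) = 1 / (1 - measure \<mu> {\<alpha>})" for \<alpha>
    using le.m_less_1[of \<alpha>] by (simp add: exp_minus le.m_def inverse_eq_divide)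
  then have Z_le: "le.Z = exp (measure \<mu> (space \<mu> - atoms \<mu>)) *
      infprod (\<lambda>\<alpha>. 1 / (1 - measure \<mu> {\<alpha>})) (atoms \<mu>)"
    by (simp add: le.Z_def le.m_def)
  note lt_moments = lt.run_length_moments[OF assms(4-6)]
  note le_moments = le.run_length_moments[OF assms(4-6)]
  show ?thesis
    unfolding Let_def
    using lt_moments le_moments
    by (simp add: Z_lt Z_le lt.T_def le.T_def lt.m_def le.m_def mult.assoc)
qed

end
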